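(* Let $\alpha\equiv\mathrm{ctrl}(x);\mathrm{plant}(u)$ where $\mathrm{ctrl}(x)$ is a hybrid program (the controller) and $\mathrm{plant}(u)$ a hybrid program (the plant, a differential equation driven by control output $u$), and let $J$ be an inductive invariant for $\alpha$; in particular $J\rightarrow[\alpha]J$ is valid. Let $\beta$ be a fallback control, i.e., a hybrid program such that for all states $\omega,\nu$ with $(\omega,\nu)\in[\![\beta]\!]$ we have $(\omega,\nu)\models\langle\mathrm{ctrl}(x)\rangle\Upsilon^+$. Let $\omega,\mu,\nu$ be states with $\omega\models J$, $(\omega,\mu)\models\langle\alpha\rangle\Upsilon^+$, and $(\mu,\nu)\not\models\langle\alpha\rangle\Upsilon^+$. Let $\tilde\mu$ be a state with $(\mu,\tilde\mu)\in[\![\beta]\!]$. Then $\tilde\nu\models J$ for all states $\tilde\nu$ with $(\tilde\mu,\tilde\nu)\in[\![\mathrm{plant}(u)]\!]$.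
   Context: Differential dynamic logic (dL): states are maps $\omega$ from a set of real-valued variables to $\mathbb{R}$. Hybrid programs are built from assignments $x:=\theta$, nondeterministic assignments $x:=*$ (any real value), tests $?F$ (continue only if formula $F$ holds, otherwise abort), differential equations $\{x'=\theta\ \&\ Q\}$ (evolve along the ODE for any nonnegative duration while staying in domain $Q$), sequential composition $\alpha;\beta$, nondeterministic choice $\alpha\cup\beta$ and nondeterministic repetition $\alpha^*$; each program $\alpha$ denotes a transition relation $[\![\alpha]\!]$ on states. dL formulas extend first-order real arithmetic with $[\alpha]\phi$ (true in $\omega$ iff $\phi$ is true in all $\nu$ with $(\omega,\nu)\in[\![\alpha]\!]$) and $\langle\alpha\rangle\phi$ (true in $\omega$ iff $\phi$ is true in some such $\nu$). A formula is valid if true in all states. $\mathrm{BV}(\alpha)$ denotes the bound variables of $\alpha$. A formula $J$ is an inductive invariant of $\alpha$ (for a safety formula $A\rightarrow[\alpha^*]S$) if $A\rightarrow J$, $J\rightarrow[\alpha]J$ and $J\rightarrow S$ are valid. For every variable $x$ there is a fresh variable $x^+$; $\Upsilon^+$ abbreviates the conjunction of $x^+=x$ over all $x\in\mathrm{BV}(\gamma)$, where $\gamma$ is the program of the modality in which $\Upsilon^+$ occurs. Transition satisfaction: $(\omega,\nu)\models\phi$ iff $\phi$ is true in the state that agrees with $\omega$ except that each $x^+$ has value $\nu(x)$; otherwise $(\omega,\nu)\not\models\phi$.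
   Formalization: Added, since the claim fails otherwise: ω and μ agree on free variables of J not bound by α, and μ and μ̃ agree on free variables of J and plant(u) not bound by ctrl(x), because Υ⁺ over BV does not constrain unbound variables. *)

theory Defs
  imports Complex_Main "HOL-Library.Finite_Map"
begin

section \<open>Syntax of differential dynamic logic\<close>

text \<open>Every variable \<open>x\<close> has its own variable \<open>Plus x\<close>, written \<open>x\<^sup>+\<close> on paper.  That it is
  fresh for a given formula or program is a separate condition, \<open>plus_free\<close> below.\<close>

datatype var = Ident string | Plus var

datatype trm =
    Const rat
  | Var var
  | Neg trm
  | Add trm trm
  | Sub trm trm
  | Mult trm trm

text \<open>\<open>Evolve ode Q\<close> is the differential equation system \<open>{x\<^sub>1' = \<theta>\<^sub>1, \<dots>, x\<^sub>n' = \<theta>\<^sub>n & Q}\<close>; the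
  finite map \<open>ode\<close> sends each \<open>x\<^sub>i\<close> to its right-hand side \<open>\<theta>\<^sub>i\<close>, so that left-hand sides are
  distinct.\<close>

datatype fml =
    TT
  | Equal trm trm
  | LessEq trm trm
  | Less trm trm
  | Negate fml
  | Conj fml fml
  | Disj fml fml
  | Impl fml fml
  | Forall var fml
  | Exists var fml
  | Box hp fml
  | Diamond hp fml
and hp =
    Assign var trm
  | AssignAny var
  | Test fml
  | Evolve "(var, trm) fmap" fml
  | Seq hp hp  (infixr ";;" 75)
  | Choice hp hp
  | Loop hp


section \<open>Semantics\<close>

type_synonym state = "var \<Rightarrow> real"

primrec trm_sem :: "trm \<Rightarrow> state \<Rightarrow> real" where
  "trm_sem (Const q) \<omega> = of_rat q"
| "trm_sem (Var x) \<omega> = \<omega> x"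
| "trm_sem (Neg \<theta>) \<omega> = - trm_sem \<theta> \<omega>"
| "trm_sem (Add \<theta> \<eta>) \<omega> = trm_sem \<theta> \<omega> + trm_sem \<eta> \<omega>"
| "trm_sem (Sub \<theta> \<eta>) \<omega> = trm_sem \<theta> \<omega> - trm_sem \<eta> \<omega>"
| "trm_sem (Mult \<theta> \<eta>) \<omega> = trm_sem \<theta> \<omega> * trm_sem \<eta> \<omega>"

text \<open>Derivatives are taken within \<open>{0..r}\<close>, hence one-sided at the end points; for \<open>r = 0\<close> the
  derivative condition is void and only the evolution domain is tested.\<close>

definition ode_sem :: "(var, trm) fmap \<Rightarrow> state set \<Rightarrow> (state \<times> state) set" where
  "ode_sem ode Q = {(\<omega>, \<nu>). \<exists>r \<phi>. 0 \<le> r \<and> \<phi> 0 = \<omega> \<and> \<phi> r = \<nu> \<and>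
     (\<forall>t\<in>{0..r}. \<phi> t \<in> Q \<and>
       (\<forall>x. case fmlookup ode x of
              None \<Rightarrow> \<phi> t x = \<omega> x
            | Some \<theta> \<Rightarrow> ((\<lambda>s. \<phi> s x) has_real_derivative trm_sem \<theta> (\<phi> t)) (at t within {0..r})))}"

primrec fml_sem :: "fml \<Rightarrow> state set" and hp_sem :: "hp \<Rightarrow> (state \<times> state) set" where
  "fml_sem TT = UNIV"
| "fml_sem (Equal \<theta> \<eta>) = {\<omega>. trm_sem \<theta> \<omega> = trm_sem \<eta> \<omega>}"
| "fml_sem (LessEq \<theta> \<eta>) = {\<omega>. trm_sem \<theta> \<omega> \<le> trm_sem \<eta> \<omega>}"
| "fml_sem (Less \<theta> \<eta>) = {\<omega>. trm_sem \<theta> \<omega> < trm_sem \<eta> \<omega>}"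
| "fml_sem (Negate \<phi>) = - fml_sem \<phi>"
| "fml_sem (Conj \<phi> \<psi>) = fml_sem \<phi> \<inter> fml_sem \<psi>"
| "fml_sem (Disj \<phi> \<psi>) = fml_sem \<phi> \<union> fml_sem \<psi>"
| "fml_sem (Impl \<phi> \<psi>) = {\<omega>. \<omega> \<in> fml_sem \<phi> \<longrightarrow> \<omega> \<in> fml_sem \<psi>}"
| "fml_sem (Forall x \<phi>) = {\<omega>. \<forall>r. \<omega>(x := r) \<in> fml_sem \<phi>}"
| "fml_sem (Exists x \<phi>) = {\<omega>. \<exists>r. \<omega>(x := r) \<in> fml_sem \<phi>}"
| "fml_sem (Box \<alpha> \<phi>) = {\<omega>. \<forall>\<nu>. (\<omega>, \<nu>) \<in> hp_sem \<alpha> \<longrightarrow> \<nu> \<in> fml_sem \<phi>}"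
| "fml_sem (Diamond \<alpha> \<phi>) = {\<omega>. \<exists>\<nu>. (\<omega>, \<nu>) \<in> hp_sem \<alpha> \<and> \<nu> \<in> fml_sem \<phi>}"
| "hp_sem (Assign x \<theta>) = {(\<omega>, \<nu>). \<nu> = \<omega>(x := trm_sem \<theta> \<omega>)}"
| "hp_sem (AssignAny x) = {(\<omega>, \<nu>). \<exists>r. \<nu> = \<omega>(x := r)}"
| "hp_sem (Test \<phi>) = {(\<omega>, \<nu>). \<nu> = \<omega> \<and> \<omega> \<in> fml_sem \<phi>}"
| "hp_sem (Evolve ode \<phi>) = ode_sem ode (fml_sem \<phi>)"
| "hp_sem (\<alpha> ;; \<beta>) = hp_sem \<alpha> O hp_sem \<beta>"
| "hp_sem (Choice \<alpha> \<beta>) = hp_sem \<alpha> \<union> hp_sem \<beta>"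
| "hp_sem (Loop \<alpha>) = (hp_sem \<alpha>)\<^sup>*"

abbreviation sat :: "state \<Rightarrow> fml \<Rightarrow> bool"  (infix "\<Turnstile>" 50) where
  "\<omega> \<Turnstile> \<phi> \<equiv> \<omega> \<in> fml_sem \<phi>"

definition valid :: "fml \<Rightarrow> bool" where
  "valid \<phi> \<longleftrightarrow> (\<forall>\<omega>. \<omega> \<Turnstile> \<phi>)"

definition inductive_invariant :: "fml \<Rightarrow> hp \<Rightarrow> fml \<Rightarrow> fml \<Rightarrow> bool" where
  "inductive_invariant A \<alpha> S J \<longleftrightarrow>
     valid (Impl A J) \<and> valid (Impl J (Box \<alpha> J)) \<and> valid (Impl J S)"


section \<open>Static semantics\<close>

primrec BV :: "hp \<Rightarrow> var set" where
  "BV (Assign x \<theta>) = {x}"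
| "BV (AssignAny x) = {x}"
| "BV (Test \<phi>) = {}"
| "BV (Evolve ode \<phi>) = fmdom' ode"
| "BV (\<alpha> ;; \<beta>) = BV \<alpha> \<union> BV \<beta>"
| "BV (Choice \<alpha> \<beta>) = BV \<alpha> \<union> BV \<beta>"
| "BV (Loop \<alpha>) = BV \<alpha>"

lemma finite_BV: "finite (BV \<alpha>)"
  by (induction \<alpha> rule: hp.induct[of "\<lambda>_. True"]) auto

text \<open>Must-bound variables: those written on every execution path.\<close>

primrec MBV :: "hp \<Rightarrow> var set" where
  "MBV (Assign x \<theta>) = {x}"
| "MBV (AssignAny x) = {x}"
| "MBV (Test \<phi>) = {}"
| "MBV (Evolve ode \<phi>) = fmdom' ode"
| "MBV (\<alpha> ;; \<beta>) = MBV \<alpha> \<union> MBV \<beta>"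
| "MBV (Choice \<alpha> \<beta>) = MBV \<alpha> \<inter> MBV \<beta>"
| "MBV (Loop \<alpha>) = {}"

primrec trm_vars :: "trm \<Rightarrow> var set" where
  "trm_vars (Const q) = {}"
| "trm_vars (Var x) = {x}"
| "trm_vars (Neg \<theta>) = trm_vars \<theta>"
| "trm_vars (Add \<theta> \<eta>) = trm_vars \<theta> \<union> trm_vars \<eta>"
| "trm_vars (Sub \<theta> \<eta>) = trm_vars \<theta> \<union> trm_vars \<eta>"
| "trm_vars (Mult \<theta> \<eta>) = trm_vars \<theta> \<union> trm_vars \<eta>"

definition ode_vars :: "(var, trm) fmap \<Rightarrow> var set" where
  "ode_vars ode = fmdom' ode \<union> (\<Union>\<theta>\<in>fmran' ode. trm_vars \<theta>)"

primrec fml_FV :: "fml \<Rightarrow> var set" and hp_FV :: "hp \<Rightarrow> var set" where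
  "fml_FV TT = {}"
| "fml_FV (Equal \<theta> \<eta>) = trm_vars \<theta> \<union> trm_vars \<eta>"
| "fml_FV (LessEq \<theta> \<eta>) = trm_vars \<theta> \<union> trm_vars \<eta>"
| "fml_FV (Less \<theta> \<eta>) = trm_vars \<theta> \<union> trm_vars \<eta>"
| "fml_FV (Negate \<phi>) = fml_FV \<phi>"
| "fml_FV (Conj \<phi> \<psi>) = fml_FV \<phi> \<union> fml_FV \<psi>"
| "fml_FV (Disj \<phi> \<psi>) = fml_FV \<phi> \<union> fml_FV \<psi>"
| "fml_FV (Impl \<phi> \<psi>) = fml_FV \<phi> \<union> fml_FV \<psi>"
| "fml_FV (Forall x \<phi>) = fml_FV \<phi> - {x}"
| "fml_FV (Exists x \<phi>) = fml_FV \<phi> - {x}"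
| "fml_FV (Box \<alpha> \<phi>) = hp_FV \<alpha> \<union> (fml_FV \<phi> - MBV \<alpha>)"
| "fml_FV (Diamond \<alpha> \<phi>) = hp_FV \<alpha> \<union> (fml_FV \<phi> - MBV \<alpha>)"
| "hp_FV (Assign x \<theta>) = trm_vars \<theta>"
| "hp_FV (AssignAny x) = {}"
| "hp_FV (Test \<phi>) = fml_FV \<phi>"
| "hp_FV (Evolve ode \<phi>) = ode_vars ode \<union> fml_FV \<phi>"
| "hp_FV (\<alpha> ;; \<beta>) = hp_FV \<alpha> \<union> (hp_FV \<beta> - MBV \<alpha>)"
| "hp_FV (Choice \<alpha> \<beta>) = hp_FV \<alpha> \<union> hp_FV \<beta>"
| "hp_FV (Loop \<alpha>) = hp_FV \<alpha>"

text \<open>All variables with any occurrence, free or bound.\<close>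

primrec fml_vars :: "fml \<Rightarrow> var set" and hp_vars :: "hp \<Rightarrow> var set" where
  "fml_vars TT = {}"
| "fml_vars (Equal \<theta> \<eta>) = trm_vars \<theta> \<union> trm_vars \<eta>"
| "fml_vars (LessEq \<theta> \<eta>) = trm_vars \<theta> \<union> trm_vars \<eta>"
| "fml_vars (Less \<theta> \<eta>) = trm_vars \<theta> \<union> trm_vars \<eta>"
| "fml_vars (Negate \<phi>) = fml_vars \<phi>"
| "fml_vars (Conj \<phi> \<psi>) = fml_vars \<phi> \<union> fml_vars \<psi>"
| "fml_vars (Disj \<phi> \<psi>) = fml_vars \<phi> \<union> fml_vars \<psi>"
| "fml_vars (Impl \<phi> \<psi>) = fml_vars \<phi> \<union> fml_vars \<psi>"
| "fml_vars (Forall x \<phi>) = insert x (fml_vars \<phi>)"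
| "fml_vars (Exists x \<phi>) = insert x (fml_vars \<phi>)"
| "fml_vars (Box \<alpha> \<phi>) = hp_vars \<alpha> \<union> fml_vars \<phi>"
| "fml_vars (Diamond \<alpha> \<phi>) = hp_vars \<alpha> \<union> fml_vars \<phi>"
| "hp_vars (Assign x \<theta>) = insert x (trm_vars \<theta>)"
| "hp_vars (AssignAny x) = {x}"
| "hp_vars (Test \<phi>) = fml_vars \<phi>"
| "hp_vars (Evolve ode \<phi>) = ode_vars ode \<union> fml_vars \<phi>"
| "hp_vars (\<alpha> ;; \<beta>) = hp_vars \<alpha> \<union> hp_vars \<beta>"
| "hp_vars (Choice \<alpha> \<beta>) = hp_vars \<alpha> \<union> hp_vars \<beta>"
| "hp_vars (Loop \<alpha>) = hp_vars \<alpha>"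

definition plus_free :: "var set \<Rightarrow> bool" where
  "plus_free X \<longleftrightarrow> X \<inter> range Plus = {}"


section \<open>Transition satisfaction and fallback controls\<close>

text \<open>The order of the conjuncts is left unspecified; the set \<open>X\<close> is meant to be finite.\<close>

definition conj_over :: "var set \<Rightarrow> (var \<Rightarrow> fml) \<Rightarrow> fml" where
  "conj_over X f = foldr (\<lambda>x. Conj (f x)) (SOME xs. set xs = X \<and> distinct xs) TT"

text \<open>\<open>Upsilon_plus \<gamma>\<close> is the formula \<open>\<Upsilon>\<^sup>+\<close> as it occurs under a modality of \<open>\<gamma>\<close>.\<close>

definition Upsilon_plus :: "hp \<Rightarrow> fml" where
  "Upsilon_plus \<gamma> = conj_over (BV \<gamma>) (\<lambda>x. Equal (Var (Plus x)) (Var x))"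

primrec plus_state :: "state \<Rightarrow> state \<Rightarrow> state" where
  "plus_state \<omega> \<nu> (Ident a) = \<omega> (Ident a)"
| "plus_state \<omega> \<nu> (Plus x) = \<nu> x"

definition trans_sat :: "state \<times> state \<Rightarrow> fml \<Rightarrow> bool"  (infix "\<Turnstile>\<^sub>t" 50) where
  "p \<Turnstile>\<^sub>t \<phi> \<longleftrightarrow> plus_state (fst p) (snd p) \<Turnstile> \<phi>"

definition fallback_control :: "hp \<Rightarrow> hp \<Rightarrow> bool" where
  "fallback_control \<beta> ctrl \<longleftrightarrow>
     (\<forall>\<omega> \<nu>. (\<omega>, \<nu>) \<in> hp_sem \<beta> \<longrightarrow> (\<omega>, \<nu>) \<Turnstile>\<^sub>t Diamond ctrl (Upsilon_plus ctrl))"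

text \<open>Satisfaction \<open>(\<omega>, \<nu>) \<Turnstile>\<^sub>t Diamond \<gamma> (Upsilon_plus \<gamma>)\<close> says nothing about the value of \<open>\<nu>\<close> at
  variables that \<open>\<gamma>\<close> does not bind, whereas a transition of \<open>\<gamma>\<close> leaves these unchanged.  The
  predicate below is that missing part, for the variables in \<open>X\<close>.\<close>

definition unchanged :: "var set \<Rightarrow> state \<Rightarrow> state \<Rightarrow> bool" where
  "unchanged X \<omega> \<nu> \<longleftrightarrow> (\<forall>x\<in>X. \<nu> x = \<omega> x)"

end

theory Submission
  imports Defs
begin

text \<open>The monitored step reaches, from a state satisfying \<open>J\<close>, a state agreeing with \<open>\<mu>\<close> on the free
  variables of \<open>J\<close>; hence \<open>J\<close> holds in \<open>\<mu>\<close>.  Likewise the fallback state \<open>\<mu>'\<close> agrees, on the free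
  variables of \<open>J\<close> and the plant, with a state that the controller itself reaches from \<open>\<mu>\<close>.  By
  coincidence every plant run from \<open>\<mu>'\<close> is mirrored by a run of \<open>ctrl ;; plant\<close> from \<open>\<mu>\<close>, so the
  invariance of \<open>J\<close> carries over.\<close>

section \<open>Static semantics\<close>

text \<open>The bound effect property. For an ODE it comes from the \<open>None\<close> branch of
  \<open>ode_sem\<close>, read at the final time \<open>r\<close>.\<close>

lemma hp_sem_unchanged: "(\<omega>, \<nu>) \<in> hp_sem \<alpha> \<Longrightarrow> x \<notin> BV \<alpha> \<Longrightarrow> \<nu> x = \<omega> x"
\<comment> \<open>\<open>fml\<close> and \<open>hp\<close> are mutually recursive; the trivial
  predicate on formulas suffices because \<open>BV\<close> does not look into tests or evolution
  domains.\<close>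
proof (induction \<alpha> arbitrary: \<omega> \<nu> rule: hp.induct[of "\<lambda>_. True"])
  case (Evolve ode Q)
  then have "fmlookup ode x = None"
    by (simp add: fmdom'_notD)
  moreover from Evolve.prems(1) obtain r \<phi> where "0 \<le> r" "\<phi> r = \<nu>"
    and "\<forall>t\<in>{0..r}. \<forall>x. case fmlookup ode x of None \<Rightarrow> \<phi> t x = \<omega> x
      | Some \<theta> \<Rightarrow> ((\<lambda>s. \<phi> s x) has_real_derivative trm_sem \<theta> (\<phi> t)) (at t within {0..r})"
    by (auto simp: ode_sem_def)
  ultimately show ?case
    by (auto dest!: bspec[of _ _ r] spec[of _ x])
next
  case (Loop \<alpha>)
  have "(\<omega>, \<nu>) \<in> (hp_sem \<alpha>)\<^sup>*"
    using Loop.prems(1) by simp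
  then show ?case
    by (induction rule: rtrancl_induct) (use Loop.prems(2) in \<open>auto dest: Loop.IH\<close>)
next
  case (Seq \<alpha> \<beta>)
  then obtain \<mu> where \<mu>: "(\<omega>, \<mu>) \<in> hp_sem \<alpha>" "(\<mu>, \<nu>) \<in> hp_sem \<beta>"
    by auto
  from Seq.IH(1)[OF \<mu>(1)] Seq.IH(2)[OF \<mu>(2)] Seq.prems(2) show ?case
    by simp
next
  case (Choice \<alpha> \<beta>)
  from Choice.prems Choice.IH(1)[of \<omega> \<nu>] Choice.IH(2)[of \<omega> \<nu>] show ?case
    by auto
qed auto

lemma BV_subset_hp_vars: "BV \<alpha> \<subseteq> hp_vars \<alpha>"
  by (induction \<alpha> rule: hp.induct[of "\<lambda>_. True"]) (auto simp: ode_vars_def)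

lemma fml_FV_subset_fml_vars: "fml_FV \<phi> \<subseteq> fml_vars \<phi>"
  and hp_FV_subset_hp_vars: "hp_FV \<alpha> \<subseteq> hp_vars \<alpha>"
  by (induction \<phi> and \<alpha>) auto

section \<open>Coincidence: dependence on free variables only\<close>

lemma unchanged_sym: "unchanged X \<omega> \<nu> \<Longrightarrow> unchanged X \<nu> \<omega>"
  by (simp add: unchanged_def)

lemma unchanged_mono: "unchanged Y \<omega> \<nu> \<Longrightarrow> X \<subseteq> Y \<Longrightarrow> unchanged X \<omega> \<nu>"
  by (auto simp: unchanged_def)

lemma unchanged_Un: "unchanged (X \<union> Y) \<omega> \<nu> \<longleftrightarrow> unchanged X \<omega> \<nu> \<and> unchanged Y \<omega> \<nu>"
  by (auto simp: unchanged_def)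

lemma trm_sem_coincidence: "unchanged (trm_vars \<theta>) \<omega> \<omega>' \<Longrightarrow> trm_sem \<theta> \<omega> = trm_sem \<theta> \<omega>'"
  by (induction \<theta>) (auto simp: unchanged_def)

text \<open>The domain enters as sets \<open>Q\<close> and \<open>Q'\<close> with a transfer
  condition, because inside the mutual induction below, coincidence for the domain formula is
  available only as an induction hypothesis.\<close>

lemma ode_sem_coincidence:
  assumes run: "(\<omega>, \<nu>) \<in> ode_sem ode Q" and eq: "unchanged V \<omega> \<omega>'" and V: "ode_vars ode \<subseteq> V"
    and Q: "\<And>\<rho> \<rho>'. unchanged V \<rho> \<rho>' \<Longrightarrow> \<rho> \<in> Q \<Longrightarrow> \<rho>' \<in> Q'"
  shows "\<exists>\<nu>'. (\<omega>', \<nu>') \<in> ode_sem ode Q' \<and> unchanged V \<nu> \<nu>'"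
proof -
  from run obtain r \<phi> where r: "0 \<le> r" "\<phi> 0 = \<omega>" "\<phi> r = \<nu>"
    and run_in: "\<forall>t\<in>{0..r}. \<phi> t \<in> Q \<and>
       (\<forall>x. case fmlookup ode x of
              None \<Rightarrow> \<phi> t x = \<omega> x
            | Some \<theta> \<Rightarrow> ((\<lambda>s. \<phi> s x) has_real_derivative trm_sem \<theta> (\<phi> t)) (at t within {0..r}))"
    by (auto simp: ode_sem_def)
  have sol: "\<phi> t \<in> Q" if "t \<in> {0..r}" for t
    using run_in that by blast
  have sol_None: "\<phi> t x = \<omega> x" if "t \<in> {0..r}" "fmlookup ode x = None" for t x
    using bspec[OF run_in that(1)] that(2) by (auto dest!: spec[of _ x])
  have sol_Some: "((\<lambda>s. \<phi> s x) has_real_derivative trm_sem \<theta> (\<phi> t)) (at t within {0..r})"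
    if "t \<in> {0..r}" "fmlookup ode x = Some \<theta>" for t x \<theta>
    using bspec[OF run_in that(1)] that(2) by (auto dest!: spec[of _ x])
  \<comment> \<open>Variables without an equation are frozen at their value in
    \<open>\<omega>'\<close>; the evolving ones copy \<open>\<phi>\<close>. Both flows then agree on
    \<open>V\<close>, which contains everything the right-hand sides read.\<close>
  define \<psi> where "\<psi> t x = (if fmlookup ode x = None then \<omega>' x else \<phi> t x)" for t x
  have agree: "unchanged V (\<phi> t) (\<psi> t)" if "t \<in> {0..r}" for t
    using eq sol_None[OF that] by (auto simp: unchanged_def \<psi>_def)
  have rhs: "trm_vars \<theta> \<subseteq> V" if "fmlookup ode x = Some \<theta>" for x \<theta>
    using fmran'I[OF that] V unfolding ode_vars_def by blast
  have start: "\<psi> 0 = \<omega>'"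
  proof
    fix x
    show "\<psi> 0 x = \<omega>' x"
    proof (cases "fmlookup ode x")
      case (Some \<theta>)
      \<comment> \<open>Left-hand sides count among \<open>ode_vars\<close>, so evolving variables
        have the same initial value in \<open>\<omega>\<close> and \<open>\<omega>'\<close>.\<close>
      then have "x \<in> V"
        using V fmdom'I[OF Some] by (auto simp: ode_vars_def)
      with Some eq r(2) show ?thesis
        by (simp add: \<psi>_def unchanged_def)
    qed (simp add: \<psi>_def)
  qed
  have deriv: "((\<lambda>s. \<psi> s x) has_real_derivative trm_sem \<theta> (\<psi> t)) (at t within {0..r})"
    if "t \<in> {0..r}" "fmlookup ode x = Some \<theta>" for t x \<theta>
  proof -
    have "trm_sem \<theta> (\<phi> t) = trm_sem \<theta> (\<psi> t)"
      using agree[OF that(1)] rhs[OF that(2)] by (intro trm_sem_coincidence) (auto simp: unchanged_def)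
    then show ?thesis
      using sol_Some[OF that] that(2) by (simp add: \<psi>_def)
  qed
  have "\<psi> t \<in> Q' \<and> (case fmlookup ode x of
              None \<Rightarrow> \<psi> t x = \<omega>' x
            | Some \<theta> \<Rightarrow> ((\<lambda>s. \<psi> s x) has_real_derivative trm_sem \<theta> (\<psi> t)) (at t within {0..r}))"
    if "t \<in> {0..r}" for t x
    using deriv[OF that] Q[OF agree[OF that] sol[OF that]]
    by (simp add: \<psi>_def split: option.split)
  with r(1) start have "(\<omega>', \<psi> r) \<in> ode_sem ode Q'"
    unfolding ode_sem_def by blast
  with agree[of r] r show ?thesis
    by auto
qed

text \<open>For programs the set \<open>V\<close> may exceed the free variables, so that agreement on the free
  variables of a postcondition survives the run.\<close>

lemma fml_sem_coincidence:
    "unchanged (fml_FV \<phi>) \<omega> \<omega>' \<Longrightarrow> \<omega> \<Turnstile> \<phi> \<longleftrightarrow> \<omega>' \<Turnstile> \<phi>"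
  and hp_sem_coincidence:
    "(\<omega>, \<nu>) \<in> hp_sem \<alpha> \<Longrightarrow> unchanged V \<omega> \<omega>' \<Longrightarrow> hp_FV \<alpha> \<subseteq> V \<Longrightarrow>
      \<exists>\<nu>'. (\<omega>', \<nu>') \<in> hp_sem \<alpha> \<and> unchanged (V \<union> MBV \<alpha>) \<nu> \<nu>'"
proof (induction \<phi> and \<alpha> arbitrary: \<omega> \<omega>' and V \<omega> \<nu> \<omega>')
  case (Equal \<theta> \<eta>)
  then have "trm_sem \<theta> \<omega> = trm_sem \<theta> \<omega>'" "trm_sem \<eta> \<omega> = trm_sem \<eta> \<omega>'"
    by (auto simp: unchanged_Un intro!: trm_sem_coincidence)
  then show ?case
    by simp
next
  case (LessEq \<theta> \<eta>)
  then have "trm_sem \<theta> \<omega> = trm_sem \<theta> \<omega>'" "trm_sem \<eta> \<omega> = trm_sem \<eta> \<omega>'"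
    by (auto simp: unchanged_Un intro!: trm_sem_coincidence)
  then show ?case
    by simp
next
  case (Less \<theta> \<eta>)
  then have "trm_sem \<theta> \<omega> = trm_sem \<theta> \<omega>'" "trm_sem \<eta> \<omega> = trm_sem \<eta> \<omega>'"
    by (auto simp: unchanged_Un intro!: trm_sem_coincidence)
  then show ?case
    by simp
next
  case (Negate \<phi>)
  from Negate.IH[of \<omega> \<omega>'] Negate.prems show ?case
    by simp
next
  case (Conj \<phi> \<psi>)
  from Conj.prems have "unchanged (fml_FV \<phi>) \<omega> \<omega>'" "unchanged (fml_FV \<psi>) \<omega> \<omega>'"
    by (auto simp: unchanged_Un)
  from Conj.IH(1)[OF this(1)] Conj.IH(2)[OF this(2)] show ?case
    by simp
next
  case (Disj \<phi> \<psi>)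
  from Disj.prems have "unchanged (fml_FV \<phi>) \<omega> \<omega>'" "unchanged (fml_FV \<psi>) \<omega> \<omega>'"
    by (auto simp: unchanged_Un)
  from Disj.IH(1)[OF this(1)] Disj.IH(2)[OF this(2)] show ?case
    by simp
next
  case (Impl \<phi> \<psi>)
  from Impl.prems have "unchanged (fml_FV \<phi>) \<omega> \<omega>'" "unchanged (fml_FV \<psi>) \<omega> \<omega>'"
    by (auto simp: unchanged_Un)
  from Impl.IH(1)[OF this(1)] Impl.IH(2)[OF this(2)] show ?case
    by simp
next
  case (Forall x \<phi>)
  have "\<omega>(x := r) \<Turnstile> \<phi> \<longleftrightarrow> \<omega>'(x := r) \<Turnstile> \<phi>" for r
    by (rule Forall.IH) (use Forall.prems in \<open>auto simp: unchanged_def\<close>)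
  then show ?case
    by simp
next
  case (Exists x \<phi>)
  have "\<omega>(x := r) \<Turnstile> \<phi> \<longleftrightarrow> \<omega>'(x := r) \<Turnstile> \<phi>" for r
    by (rule Exists.IH) (use Exists.prems in \<open>auto simp: unchanged_def\<close>)
  then show ?case
    by simp
next
  case (Box \<alpha> \<phi>)
  \<comment> \<open>The induction hypothesis simulates runs in one direction only, and a box needs
    runs from \<open>\<rho>'\<close> mirrored from \<open>\<rho>\<close>; symmetry of agreement then
    yields the equivalence. With \<open>V\<close> the free variables of the whole formula,
    \<open>V \<union> MBV \<alpha>\<close> covers those of the postcondition.\<close>
  have transfer: "\<rho>' \<Turnstile> Box \<alpha> \<phi>"
    if box: "\<rho> \<Turnstile> Box \<alpha> \<phi>" and eq: "unchanged (fml_FV (Box \<alpha> \<phi>)) \<rho>' \<rho>" for \<rho> \<rho>'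
    unfolding fml_sem.simps
  proof (intro CollectI allI impI)
    fix \<sigma>' assume "(\<rho>', \<sigma>') \<in> hp_sem \<alpha>"
    from Box.IH(1)[OF this eq] obtain \<sigma> where \<sigma>: "(\<rho>, \<sigma>) \<in> hp_sem \<alpha>"
      "unchanged (fml_FV (Box \<alpha> \<phi>) \<union> MBV \<alpha>) \<sigma>' \<sigma>"
      by auto
    then show "\<sigma>' \<Turnstile> \<phi>"
      using box Box.IH(2)[of \<sigma>' \<sigma>] by (auto intro: unchanged_mono)
  qed
  from Box.prems show ?case
    using transfer unchanged_sym by blast
next
  case (Diamond \<alpha> \<phi>)
  have transfer: "\<rho>' \<Turnstile> Diamond \<alpha> \<phi>"
    if dia: "\<rho> \<Turnstile> Diamond \<alpha> \<phi>" and eq: "unchanged (fml_FV (Diamond \<alpha> \<phi>)) \<rho> \<rho>'" for \<rho> \<rho>'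
  proof -
    from dia obtain \<sigma> where \<sigma>: "(\<rho>, \<sigma>) \<in> hp_sem \<alpha>" "\<sigma> \<Turnstile> \<phi>"
      by auto
    from Diamond.IH(1)[OF \<sigma>(1) eq] obtain \<sigma>' where \<sigma>': "(\<rho>', \<sigma>') \<in> hp_sem \<alpha>"
      "unchanged (fml_FV (Diamond \<alpha> \<phi>) \<union> MBV \<alpha>) \<sigma> \<sigma>'"
      by auto
    then show ?thesis
      using \<sigma>(2) Diamond.IH(2)[of \<sigma> \<sigma>'] by (auto intro: unchanged_mono)
  qed
  from Diamond.prems show ?case
    using transfer unchanged_sym by blast
next
  case (Assign x \<theta>)
  then have "trm_sem \<theta> \<omega> = trm_sem \<theta> \<omega>'"
    by (intro trm_sem_coincidence) (auto intro: unchanged_mono)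
  with Assign.prems show ?case
    by (auto simp: unchanged_def)
next
  case (AssignAny x)
  then obtain r where "\<nu> = \<omega>(x := r)"
    by auto
  with AssignAny.prems show ?case
    by (auto simp: unchanged_def intro!: exI[of _ "\<omega>'(x := r)"])
next
  case (Test \<phi>)
  then have "unchanged (fml_FV \<phi>) \<omega> \<omega>'"
    by (auto intro: unchanged_mono)
  with Test show ?case
    by auto
next
  case (Evolve ode \<phi>)
  have dom: "fmdom' ode \<subseteq> V"
    using Evolve.prems(3) by (auto simp: ode_vars_def)
  have "\<rho>' \<Turnstile> \<phi>" if "unchanged V \<rho> \<rho>'" "\<rho> \<Turnstile> \<phi>" for \<rho> \<rho>'
    using that Evolve.IH[of \<rho> \<rho>'] Evolve.prems(3) by (auto intro: unchanged_mono)
  then show ?case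
    using ode_sem_coincidence[of \<omega> \<nu> ode "fml_sem \<phi>" V \<omega>' "fml_sem \<phi>"] Evolve.prems dom
    by (auto simp: Un_absorb2)
next
  case (Seq \<alpha> \<beta>)
  then obtain \<mu> where \<mu>: "(\<omega>, \<mu>) \<in> hp_sem \<alpha>" "(\<mu>, \<nu>) \<in> hp_sem \<beta>"
    by auto
  from Seq.IH(1)[OF \<mu>(1) Seq.prems(2)] Seq.prems(3) obtain \<mu>'
    where \<mu>': "(\<omega>', \<mu>') \<in> hp_sem \<alpha>" "unchanged (V \<union> MBV \<alpha>) \<mu> \<mu>'"
    by auto
  \<comment> \<open>What \<open>\<alpha>\<close> surely writes agrees after its run, so
    \<open>\<beta>\<close> is treated with this larger set in place of \<open>V\<close>.\<close>
  have "hp_FV \<beta> \<subseteq> V \<union> MBV \<alpha>"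
    using Seq.prems(3) by auto
  from Seq.IH(2)[OF \<mu>(2) \<mu>'(2) this] \<mu>'(1) show ?case
    by (auto simp: Un_assoc)
next
  case (Choice \<alpha> \<beta>)
  have "\<exists>\<nu>'. (\<omega>', \<nu>') \<in> hp_sem \<gamma> \<and> unchanged (V \<union> MBV (Choice \<alpha> \<beta>)) \<nu> \<nu>'"
    if "\<gamma> = \<alpha> \<or> \<gamma> = \<beta>" "(\<omega>, \<nu>) \<in> hp_sem \<gamma>" for \<gamma>
  proof -
    have "\<exists>\<nu>'. (\<omega>', \<nu>') \<in> hp_sem \<gamma> \<and> unchanged (V \<union> MBV \<gamma>) \<nu> \<nu>'"
      using that Choice.IH(1)[OF _ Choice.prems(2)] Choice.IH(2)[OF _ Choice.prems(2)]
        Choice.prems(3) by auto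
    then show ?thesis
      using that(1) by (elim exE) (auto simp: unchanged_def)
  qed
  with Choice.prems(1) show ?case
    by auto
next
  case (Loop \<alpha>)
  have "(\<omega>, \<nu>) \<in> (hp_sem \<alpha>)\<^sup>*"
    using Loop.prems(1) by simp
  \<comment> \<open>A loop may run zero times and has empty \<open>MBV\<close>, so agreement on
    \<open>V\<close> alone is carried through the iterations.\<close>
  then have "\<exists>\<nu>'. (\<omega>', \<nu>') \<in> (hp_sem \<alpha>)\<^sup>* \<and> unchanged V \<nu> \<nu>'"
  proof (induction rule: rtrancl_induct)
    case base
    show ?case
      using Loop.prems(2) by blast
  next
    case (step \<mu> \<nu>)
    then obtain \<mu>' where \<mu>': "(\<omega>', \<mu>') \<in> (hp_sem \<alpha>)\<^sup>*" "unchanged V \<mu> \<mu>'"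
      by blast
    from Loop.IH[OF step.hyps(2) \<mu>'(2)] Loop.prems(3) obtain \<nu>'
      where "(\<mu>', \<nu>') \<in> hp_sem \<alpha>" "unchanged (V \<union> MBV \<alpha>) \<nu> \<nu>'"
      by auto
    with \<mu>'(1) show ?case
      by (blast intro: rtrancl_into_rtrancl unchanged_mono)
  qed
  then show ?case
    by simp
qed simp

section \<open>Transition satisfaction\<close>

text \<open>Finiteness makes the \<open>SOME\<close> in \<open>conj_over\<close> denote an actual
  enumeration of \<open>X\<close>, so its unspecified order is harmless.\<close>

lemma sat_conj_over:
  assumes "finite X"
  shows "\<omega> \<Turnstile> conj_over X f \<longleftrightarrow> (\<forall>x\<in>X. \<omega> \<Turnstile> f x)"
proof -
  have "\<omega> \<Turnstile> foldr (\<lambda>x. Conj (f x)) xs TT \<longleftrightarrow> (\<forall>x\<in>set xs. \<omega> \<Turnstile> f x)" for xs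
    by (induction xs) auto
  moreover have "set (SOME xs. set xs = X \<and> distinct xs) = X"
    using someI_ex[OF finite_distinct_list[OF assms]] by blast
  ultimately show ?thesis
    unfolding conj_over_def by simp
qed

lemma sat_Upsilon_plus: "\<omega> \<Turnstile> Upsilon_plus \<gamma> \<longleftrightarrow> (\<forall>x\<in>BV \<gamma>. \<omega> (Plus x) = \<omega> x)"
  unfolding Upsilon_plus_def by (simp add: sat_conj_over finite_BV)

lemma unchanged_plus_state: "plus_free X \<Longrightarrow> unchanged X \<omega> (plus_state \<omega> \<nu>)"
  unfolding unchanged_def plus_free_def
proof
  fix x assume "X \<inter> range Plus = {}" "x \<in> X"
  then show "plus_state \<omega> \<nu> x = \<omega> x"
    by (cases x) auto
qed

text \<open>Turns transition satisfaction back into an actual run. On bound variables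
  \<open>Upsilon_plus\<close> forces the end state to match \<open>\<nu>\<close>; on the others the
  run changes nothing and \<open>frame\<close> supplies the match.\<close>

lemma trans_sat_DiamondE:
  assumes sat: "(\<omega>, \<nu>) \<Turnstile>\<^sub>t Diamond \<gamma> (Upsilon_plus \<gamma>)" and \<gamma>: "plus_free (BV \<gamma>)"
    and X: "plus_free X" and frame: "unchanged (X - BV \<gamma>) \<omega> \<nu>"
  obtains \<rho> where "(plus_state \<omega> \<nu>, \<rho>) \<in> hp_sem \<gamma>" "unchanged X \<rho> \<nu>"
proof -
  from sat obtain \<rho> where run: "(plus_state \<omega> \<nu>, \<rho>) \<in> hp_sem \<gamma>"
    and ups: "\<And>x. x \<in> BV \<gamma> \<Longrightarrow> \<rho> (Plus x) = \<rho> x"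
    by (auto simp: trans_sat_def sat_Upsilon_plus)
  have "\<nu> x = \<rho> x" if "x \<in> X" for x
  proof (cases "x \<in> BV \<gamma>")
    case True
    \<comment> \<open>The run therefore keeps \<open>Plus x\<close> at its initial value, which
      \<open>plus_state\<close> sets to \<open>\<nu> x\<close>.\<close>
    have "Plus x \<notin> BV \<gamma>"
      using \<gamma> by (auto simp: plus_free_def)
    from hp_sem_unchanged[OF run this] ups[OF True] show ?thesis
      by simp
  next
    case False
    have "plus_state \<omega> \<nu> x = \<omega> x"
      using unchanged_plus_state[OF X] that by (auto simp: unchanged_def)
    with hp_sem_unchanged[OF run False] frame that False show ?thesis
      by (simp add: unchanged_def)
  qed
  with run that show thesis
    by (auto simp: unchanged_def)
qed

theorem theorem2:
  fixes ctrl plant \<alpha> \<beta> :: hp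
    and A S J :: fml
    and \<omega> \<mu> \<nu> \<mu>' :: state
  assumes alpha: "\<alpha> = ctrl ;; plant"
    and fresh: "plus_free (hp_vars \<alpha>)" "plus_free (fml_vars J)"
    and invariant: "inductive_invariant A \<alpha> S J"
    and fallback: "fallback_control \<beta> ctrl"
    and init: "\<omega> \<Turnstile> J"
    and monitor: "(\<omega>, \<mu>) \<Turnstile>\<^sub>t Diamond \<alpha> (Upsilon_plus \<alpha>)"
    and frame_monitor: "unchanged (fml_FV J - BV \<alpha>) \<omega> \<mu>"
    and violation: "\<not> (\<mu>, \<nu>) \<Turnstile>\<^sub>t Diamond \<alpha> (Upsilon_plus \<alpha>)"
    and step: "(\<mu>, \<mu>') \<in> hp_sem \<beta>"
    and frame_fallback: "unchanged ((fml_FV J \<union> hp_FV plant) - BV ctrl) \<mu> \<mu>'"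
  shows "\<forall>\<nu>'. (\<mu>', \<nu>') \<in> hp_sem plant \<longrightarrow> \<nu>' \<Turnstile> J"
proof (intro allI impI)
  fix \<nu>' assume plant_run: "(\<mu>', \<nu>') \<in> hp_sem plant"
  have free: "plus_free (fml_FV J)" "plus_free (BV \<alpha>)" "plus_free (BV ctrl)"
    "plus_free (fml_FV J \<union> hp_FV plant)"
    using fresh fml_FV_subset_fml_vars[of J] BV_subset_hp_vars[of \<alpha>] hp_FV_subset_hp_vars[of plant]
    unfolding alpha plus_free_def by auto
  have J_step: "\<tau> \<Turnstile> J" if "(\<sigma>, \<tau>) \<in> hp_sem \<alpha>" "\<sigma> \<Turnstile> J" for \<sigma> \<tau>
    using invariant that unfolding inductive_invariant_def valid_def by auto
  \<comment> \<open>The extracted runs start in a \<open>plus_state\<close>, where only plus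
    variables are overwritten; \<open>J\<close> does not mention these.\<close>
  have J_plus: "plus_state \<sigma> \<tau> \<Turnstile> J" if "\<sigma> \<Turnstile> J" for \<sigma> \<tau>
    using that fml_sem_coincidence[OF unchanged_plus_state[OF free(1)], of \<sigma> \<tau>] by simp
  obtain \<rho> where \<rho>: "(plus_state \<omega> \<mu>, \<rho>) \<in> hp_sem \<alpha>" "unchanged (fml_FV J) \<rho> \<mu>"
    using trans_sat_DiamondE[OF monitor free(2,1) frame_monitor] .
  have J_\<mu>: "\<mu> \<Turnstile> J"
    using J_step[OF \<rho>(1) J_plus[OF init]] fml_sem_coincidence[OF \<rho>(2)] by simp
  have "(\<mu>, \<mu>') \<Turnstile>\<^sub>t Diamond ctrl (Upsilon_plus ctrl)"
    using fallback step unfolding fallback_control_def by blast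
  \<comment> \<open>Agreement must include \<open>hp_FV plant\<close> here, so that the plant run
    from \<open>\<mu>'\<close> can be replayed from \<open>\<sigma>\<close>.\<close>
  then obtain \<sigma> where \<sigma>: "(plus_state \<mu> \<mu>', \<sigma>) \<in> hp_sem ctrl"
    "unchanged (fml_FV J \<union> hp_FV plant) \<sigma> \<mu>'"
    using trans_sat_DiamondE[OF _ free(3,4) frame_fallback] by blast
  \<comment> \<open>\<open>V\<close> is \<open>fml_FV J \<union> hp_FV plant\<close>: the plant part
    permits the replay, the \<open>J\<close> part makes the end states agree on
    \<open>J\<close>.\<close>
  from hp_sem_coincidence[OF plant_run unchanged_sym[OF \<sigma>(2)]] obtain \<tau>
    where \<tau>: "(\<sigma>, \<tau>) \<in> hp_sem plant" "unchanged (fml_FV J) \<nu>' \<tau>"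
    by (auto simp: unchanged_Un)
  \<comment> \<open>The controller run to \<open>\<sigma>\<close> and the replayed plant run to
    \<open>\<tau>\<close> compose to one run of \<open>\<alpha>\<close> from a state satisfying
    \<open>J\<close>.\<close>
  then have "\<tau> \<Turnstile> J"
    using J_step[OF _ J_plus[OF J_\<mu>]] \<sigma>(1) by (auto simp: alpha)
  with fml_sem_coincidence[OF \<tau>(2)] show "\<nu>' \<Turnstile> J"
    by simp
qed

end
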